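(* Let $\mathcal{F}$ be a union-closed family of finite sets with $\emptyset\in\mathcal{F}$ such that every member of $J(\mathcal{F})$ has one or two elements, let $U=\{a,b\}\in J(\mathcal{F})$ with $a\neq b$, and suppose $\mathcal{F}=\mathcal{N}^3_{\mathcal{F}}(U)$. Let $J'(\mathcal{F})=\{V\in J(\mathcal{F}):|V|=2\}$. If for every $V\in J'(\mathcal{F})$ with $V\cap U\neq\emptyset$ we have $d_{J'(\mathcal{F})}(V)\ge d_{J'(\mathcal{F})}(U)$, then for every extension $\mathcal{F}'$ of $(\mathcal{F},U)$, $\mu_{\mathcal{F},\mathcal{F}'}(U)\ge 2$.
   Context: All sets are finite. For families $\mathcal{A},\mathcal{B}$ of sets, $\mathcal{A}\vee\mathcal{B}=\{A\cup B: A\in\mathcal{A},B\in\mathcal{B}\}$, and for a set $Z$, $\mathcal{A}_{\setminus Z}=\{A\setminus Z: A\in\mathcal{A}\}$. $J(\mathcal{F})$ is the set of union generators of $\mathcal{F}$: the nonempty $V\in\mathcal{F}$ not equal to the union of the members of $\mathcal{F}$ properly contained in $V$. For a set $X$, $\pi_{\mathcal{F}}(X)=\bigcup\{V\in\mathcal{F}:V\subseteq X\}$. For a set $W$, $\mathcal{N}_{\mathcal{F}}(W)$ is the family of all unions of subfamilies of $\{V\in J(\mathcal{F}):V\cap W\neq\emptyset\}$ (the empty union being $\emptyset$), and $\mathcal{N}^3_{\mathcal{F}}(U)=\mathcal{N}_{\mathcal{F}}\big(\bigcup\mathcal{N}_{\mathcal{F}}(U)\big)$. A union-closed family $\mathcal{F}'$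 is an extension of $(\mathcal{F},U)$ if $\mathcal{F}'=\mathcal{F}\vee\mathcal{H}$ for some nonempty union-closed family $\mathcal{H}$ with $(\bigcup\mathcal{H})\cap U=\emptyset$. For $X$ with $X\cap U=\emptyset$, $E_{\mathcal{F},U}(X)$ is the set of $Y\subseteq U$ with $\pi_{\mathcal{F}}(X\cup Y)\cap U=Y$ and $\pi_{\mathcal{F}}(X\cup Y)\supseteq\pi_{\mathcal{F}}(X\cup U)\setminus U$. For an extension $\mathcal{F}'$, $\mu_{\mathcal{F},\mathcal{F}'}(U)=\sum_{X\in\mathcal{F}'_{\setminus U}}|E_{\mathcal{F},U}(X)|\,/\,|\mathcal{F}'_{\setminus U}|$. For a family $\mathcal{G}$ and set $V$, $d_{\mathcal{G}}(V)=|\{W\in\mathcal{G}\setminus\{V\}:W\cap V\neq\emptyset\}|$. *)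

theory Defs
  imports Complex_Main
begin

definition union_closed :: "'a set set \<Rightarrow> bool" where
  "union_closed \<F> \<longleftrightarrow> (\<forall>A\<in>\<F>. \<forall>B\<in>\<F>. A \<union> B \<in> \<F>)"

definition family_join :: "'a set set \<Rightarrow> 'a set set \<Rightarrow> 'a set set" where
  "family_join \<A> \<B> = {A \<union> B |A B. A \<in> \<A> \<and> B \<in> \<B>}"

definition family_minus :: "'a set set \<Rightarrow> 'a set \<Rightarrow> 'a set set" where
  "family_minus \<A> Z = {A - Z |A. A \<in> \<A>}"

definition union_generators :: "'a set set \<Rightarrow> 'a set set" where
  "union_generators \<F> = {V \<in> \<F>. V \<noteq> {} \<and> V \<noteq> \<Union>{W \<in> \<F>. W \<subset> V}}"

definition family_proj :: "'a set set \<Rightarrow> 'a set \<Rightarrow> 'a set" where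
  "family_proj \<F> X = \<Union>{V \<in> \<F>. V \<subseteq> X}"

definition nbhd :: "'a set set \<Rightarrow> 'a set \<Rightarrow> 'a set set" where
  "nbhd \<F> W = {\<Union>\<S> |\<S>. \<S> \<subseteq> {V \<in> union_generators \<F>. V \<inter> W \<noteq> {}}}"

definition nbhd3 :: "'a set set \<Rightarrow> 'a set \<Rightarrow> 'a set set" where
  "nbhd3 \<F> U = nbhd \<F> (\<Union>(nbhd \<F> U))"

text \<open>Families and their members are finite throughout, so finiteness of the witness
  \<open>\<H>\<close> is part of the notion of extension.\<close>

definition is_extension :: "'a set set \<Rightarrow> 'a set \<Rightarrow> 'a set set \<Rightarrow> bool" where
  "is_extension \<F> U \<F>' \<longleftrightarrow> union_closed \<F>' \<and>
     (\<exists>\<H>. finite \<H> \<and> (\<forall>A\<in>\<H>. finite A) \<and> \<H> \<noteq> {} \<and> union_closed \<H> \<and>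
          (\<Union>\<H>) \<inter> U = {} \<and> \<F>' = family_join \<F> \<H>)"

text \<open>Only used for \<open>X\<close> disjoint from \<open>U\<close>.\<close>

definition E_set :: "'a set set \<Rightarrow> 'a set \<Rightarrow> 'a set \<Rightarrow> 'a set set" where
  "E_set \<F> U X = {Y. Y \<subseteq> U \<and> family_proj \<F> (X \<union> Y) \<inter> U = Y \<and>
                     family_proj \<F> (X \<union> Y) \<supseteq> family_proj \<F> (X \<union> U) - U}"

definition mu :: "'a set set \<Rightarrow> 'a set set \<Rightarrow> 'a set \<Rightarrow> real" where
  "mu \<F> \<F>' U =
     (\<Sum>X\<in>family_minus \<F>' U. real (card (E_set \<F> U X))) / real (card (family_minus \<F>' U))"

definition family_degree :: "'a set set \<Rightarrow> 'a set \<Rightarrow> nat" where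
  "family_degree \<G> V = card {W \<in> \<G> - {V}. W \<inter> V \<noteq> {}}"

definition union_generators2 :: "'a set set \<Rightarrow> 'a set set" where
  "union_generators2 \<F> = {V \<in> union_generators \<F>. card V = 2}"

end

theory Submission
  imports Defs "HOL-Library.FuncSet"
begin

text \<open>Regard the two-element generators as the edges of a graph, and let \<open>A\<close> and \<open>B\<close> be the
  neighbourhoods of \<open>a\<close> and \<open>b\<close> outside \<open>U\<close>. The degree hypothesis says that every vertex of
  \<open>A - B\<close> has at least \<open>|B|\<close> neighbours outside \<open>U\<close>, and every vertex of \<open>B - A\<close> at least \<open>|A|\<close>.
  A set \<open>X\<close> disjoint from \<open>A \<union> B\<close> has both \<open>{}\<close> and \<open>U\<close> in \<open>E(X)\<close>; a set meeting \<open>A \<union> B\<close>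
  satisfies \<open>|E(X)| \<ge> 1 + [G\<^sub>A] + [G\<^sub>B]\<close>, where \<open>G\<^sub>A\<close> is the event that no vertex of \<open>A - B\<close> is
  isolated in \<open>X\<close>, and symmetrically for \<open>G\<^sub>B\<close>. An isolated vertex of \<open>X\<close> in \<open>A \<union> B\<close> may be given an
  arbitrary set of neighbours without leaving the family, so imposing non-isolation of one further
  vertex of \<open>A - B\<close> keeps at least a \<open>1 - 1 / 2 ^ |B|\<close> fraction of the sets. Hence, for \<open>X\<close> uniform
  among the members meeting \<open>A \<union> B\<close>, the probabilities of \<open>G\<^sub>A\<close> and \<open>G\<^sub>B\<close> sum to at least
  \<open>(1 - 1 / 2 ^ |B|) ^ |A| + (1 - 1 / 2 ^ |A|) ^ |B| \<ge> 1\<close>.\<close>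

section \<open>A counting inequality for \<open>0\<close>-\<open>1\<close> matrices\<close>

text \<open>A \<open>0\<close>-\<open>1\<close> matrix of format \<open>p \<times> q\<close> cannot have both a zero row and a column of ones.\<close>

lemma two_power_mult_le:
  "(2::nat) ^ (p * q) \<le> (2 ^ q - 1) ^ p + (2 ^ p - 1) ^ q"
proof -
  define P Q where "P = {..<p}" and "Q = {..<q}"
  have fin: "finite P" "finite Q" and cards: "card P = p" "card Q = q"
    by (auto simp: P_def Q_def)
  define M where "M = PiE P (\<lambda>_. Pow Q)"
  define R where "R = PiE P (\<lambda>_. Pow Q - {{}})"
  define C where "C = PiE Q (\<lambda>_. Pow P - {{}})"
  \<comment> \<open>Here \<open>f i\<close> is the set of ones in row \<open>i\<close>, so
    \<open>R\<close> holds the matrices without a zero row. In \<open>C\<close>, \<open>g j\<close>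
    is the set of zeros of column \<open>j\<close>, and \<open>\<phi>\<close> turns this column
    description into rows.\<close>
  define \<phi> where "\<phi> g = (\<lambda>i\<in>P. {j\<in>Q. i \<notin> g j})" for g :: "nat \<Rightarrow> nat set"
  have cM: "card M = 2 ^ (p * q)"
    using fin cards by (simp add: M_def card_PiE card_Pow mult.commute flip: power_mult)
  have cR: "card R = (2 ^ q - 1) ^ p" and cC: "card C = (2 ^ p - 1) ^ q"
    using fin cards by (simp_all add: R_def C_def card_PiE card_Pow card_Diff_singleton)
  have finRC: "finite R" "finite C"
    using fin by (auto simp: R_def C_def intro!: finite_PiE)
  have "M \<subseteq> R \<union> \<phi> ` C"
  proof
    fix f assume f: "f \<in> M"
    show "f \<in> R \<union> \<phi> ` C"
    proof (cases "f \<in> R")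
      case False
      then obtain i where i: "i \<in> P" "f i = {}"
        using f by (fastforce simp: M_def R_def PiE_iff)
      define g where "g = (\<lambda>j\<in>Q. {k\<in>P. j \<notin> f k})"
      have "g \<in> C"
        using i by (auto simp: g_def C_def)
      moreover have "f = \<phi> g"
      proof
        fix k show "f k = \<phi> g k"
          using f by (cases "k \<in> P") (auto simp: M_def \<phi>_def g_def PiE_iff extensional_def)
      qed
      ultimately show ?thesis by blast
    qed simp
  qed
  then have "card M \<le> card (R \<union> \<phi> ` C)"
    using finRC by (intro card_mono) auto
  also have "\<dots> \<le> card R + card C"
    using card_Un_le[of R "\<phi> ` C"] card_image_le[OF finRC(2), of \<phi>] by linarith
  finally show ?thesis
    by (simp add: cM cR cC)
qed

text \<open>The count divided by \<open>2 ^ (p * q)\<close>: for a uniformly random matrix the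
  summands are the probabilities of no zero row and of no column of ones.\<close>

lemma one_le_sum_powers:
  "1 \<le> (1 - 1 / 2 ^ q) ^ p + (1 - 1 / 2 ^ p :: real) ^ q"
proof -
  have eq: "(1 - 1 / 2 ^ n :: real) ^ m = real ((2 ^ n - 1) ^ m) / 2 ^ (n * m)" for m n :: nat
  proof -
    have "(1 - 1 / 2 ^ n :: real) = real (2 ^ n - 1) / 2 ^ n"
      by (simp add: field_simps)
    then show ?thesis
      by (simp add: power_divide power_mult)
  qed
  have "real (2 ^ (p * q)) \<le> real ((2 ^ q - 1) ^ p + (2 ^ p - 1) ^ q)"
    using two_power_mult_le of_nat_le_iff by blast
  then show ?thesis
    by (simp add: eq mult.commute[of q p] flip: add_divide_distrib)
qed

section \<open>Sets without isolated vertices\<close>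

text \<open>Induction on \<open>S\<close>. Adding \<open>y\<close> loses the sets \<open>D\<close>
  in which \<open>y\<close> is isolated. Adjoining any subset of \<open>N y\<close> to a set in
  \<open>D\<close> stays in \<open>G\<close>, and all results are distinct, so \<open>D\<close> is
  at most a \<open>1 / 2 ^ p\<close> fraction of \<open>G\<close>.\<close>

lemma card_nonisolated_ge:
  fixes N :: "'a \<Rightarrow> 'a set"
  assumes "finite S" and "finite \<Omega>"
    and "\<And>y z. y \<in> S \<Longrightarrow> z \<in> S \<Longrightarrow> y \<in> N z \<Longrightarrow> z \<in> N y"
    and "\<And>y. y \<in> S \<Longrightarrow> finite (N y) \<and> p \<le> card (N y)"
    and "\<And>X y Z. X \<in> \<Omega> \<Longrightarrow> y \<in> S \<Longrightarrow> y \<in> X \<Longrightarrow> Z \<subseteq> N y \<Longrightarrow> X \<union> Z \<in> \<Omega>"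
  shows "real (card \<Omega>) * (1 - 1 / 2 ^ p) ^ card S
           \<le> real (card {X \<in> \<Omega>. \<forall>y\<in>S \<inter> X. N y \<inter> X \<noteq> {}})"
  using assms(1,3-5)
proof (induction S rule: finite_induct)
  case empty
  then show ?case by simp
next
  case (insert y S)
  define G where "G = {X \<in> \<Omega>. \<forall>y\<in>S \<inter> X. N y \<inter> X \<noteq> {}}"
  define D where "D = {X \<in> G. y \<in> X \<and> N y \<inter> X = {}}"
  have IH: "real (card \<Omega>) * (1 - 1 / 2 ^ p) ^ card S \<le> real (card G)"
    unfolding G_def by (rule insert.IH) (use insert.prems in blast)+
  have finG: "finite G" and finD: "finite D"
    using \<open>finite \<Omega>\<close> by (auto simp: G_def D_def)
  have Ny: "finite (N y)" "p \<le> card (N y)"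
    using insert.prems(2) by auto
  have "inj_on (\<lambda>(X, Z). X \<union> Z) (D \<times> Pow (N y))"
  proof (rule inj_onI, clarify)
    fix X Z X' Z'
    assume XZ: "X \<in> D" "X' \<in> D" "Z \<subseteq> N y" "Z' \<subseteq> N y" "X \<union> Z = X' \<union> Z'"
    \<comment> \<open>Since \<open>X\<close> misses \<open>N y\<close>, the union determines both of
      its parts.\<close>
    have "X = (X \<union> Z) - N y" "X' = (X' \<union> Z') - N y"
         "Z = (X \<union> Z) \<inter> N y" "Z' = (X' \<union> Z') \<inter> N y"
      using XZ(1-4) by (auto simp: D_def)
    then show "X = X' \<and> Z = Z'"
      using XZ(5) by metis
  qed
  moreover have "(\<lambda>(X, Z). X \<union> Z) ` (D \<times> Pow (N y)) \<subseteq> G"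
  proof clarify
    fix X Z assume X: "X \<in> D" and Z: "Z \<subseteq> N y"
    have "X \<union> Z \<in> \<Omega>"
      using X Z insert.prems(3) by (auto simp: D_def G_def)
    moreover have "N v \<inter> (X \<union> Z) \<noteq> {}" if "v \<in> S" "v \<in> X \<union> Z" for v
    proof (cases "v \<in> X")
      case True
      then show ?thesis using X that by (auto simp: D_def G_def)
    next
      case False
      \<comment> \<open>A vertex of \<open>S\<close> brought in by \<open>Z\<close> is not isolated:
        by symmetry \<open>y\<close>, which lies in \<open>X\<close>, is its neighbour.\<close>
      then have "v \<in> N y" using that Z by auto
      then have "y \<in> N v" using insert.prems(1) that by auto
      then show ?thesis using X by (auto simp: D_def)
    qed
    ultimately show "X \<union> Z \<in> G" by (auto simp: G_def)
  qed
  ultimately have "card (D \<times> Pow (N y)) \<le> card G"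
    using card_inj_on_le finG by blast
  then have "card D * 2 ^ card (N y) \<le> card G"
    using Ny by (simp add: card_cartesian_product card_Pow)
  moreover have "card D * 2 ^ p \<le> card D * 2 ^ card (N y)"
    using Ny by (intro mult_left_mono power_increasing) auto
  ultimately have "card D * 2 ^ p \<le> card G" by linarith
  then have "real (card D * 2 ^ p) \<le> real (card G)" by (simp only: of_nat_le_iff)
  then have D_le: "real (card D) \<le> real (card G) / 2 ^ p"
    by (simp add: field_simps)
  have split: "{X \<in> \<Omega>. \<forall>v\<in>insert y S \<inter> X. N v \<inter> X \<noteq> {}} = G - D"
    by (auto simp: G_def D_def)
  have "card (G - D) = card G - card D" "card D \<le> card G"
    using finG finD by (auto simp: D_def intro!: card_Diff_subset card_mono)
  then have cGD: "real (card (G - D)) = real (card G) - real (card D)"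
    by simp
  have "real (card \<Omega>) * (1 - 1 / 2 ^ p) ^ card (insert y S)
          = real (card \<Omega>) * (1 - 1 / 2 ^ p) ^ card S * (1 - 1 / 2 ^ p)"
    using insert.hyps by simp
  also have "\<dots> \<le> real (card G) * (1 - 1 / 2 ^ p)"
    using IH by (intro mult_right_mono) auto
  also have "\<dots> \<le> real (card (G - D))"
    using D_le unfolding cGD by (simp add: right_diff_distrib)
  finally show ?case unfolding split .
qed

section \<open>Neighbourhoods and edge degrees\<close>

definition nbrs :: "'a set set \<Rightarrow> 'a \<Rightarrow> 'a set" where
  "nbrs G v = {w. {v, w} \<in> G}"

lemma nbrs_sym: "v \<in> nbrs G w \<longleftrightarrow> w \<in> nbrs G v"
  by (simp add: nbrs_def insert_commute)

lemma bij_betw_nbrs: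
  assumes "\<forall>V\<in>G. card V = 2"
  shows "bij_betw (\<lambda>w. {v, w}) (nbrs G v) {W \<in> G. v \<in> W}"
  unfolding bij_betw_def
proof
  show "inj_on (\<lambda>w. {v, w}) (nbrs G v)"
    by (auto simp: inj_on_def doubleton_eq_iff)
  show "(\<lambda>w. {v, w}) ` nbrs G v = {W \<in> G. v \<in> W}"
  proof
    show "{W \<in> G. v \<in> W} \<subseteq> (\<lambda>w. {v, w}) ` nbrs G v"
    proof clarify
      fix W assume W: "W \<in> G" "v \<in> W"
      then obtain x y where "W = {x, y}" using assms by (metis card_2_iff)
      then obtain w where "W = {v, w}" using W(2) by (auto simp: insert_commute)
      then show "W \<in> (\<lambda>w. {v, w}) ` nbrs G v" using W(1) by (auto simp: nbrs_def)
    qed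
  qed (auto simp: nbrs_def)
qed

lemma finite_nbrs:
  assumes "finite G" and "\<forall>V\<in>G. card V = 2"
  shows "finite (nbrs G v)"
  using bij_betw_finite[OF bij_betw_nbrs[OF assms(2)]] assms(1) by auto

text \<open>The other edges meeting \<open>{v, w}\<close> contain exactly one of \<open>v\<close>
  and \<open>w\<close>. The edge itself is counted at both ends, whence the
  \<open>2\<close>.\<close>

lemma family_degree_edge:
  assumes "finite G" and "\<forall>V\<in>G. card V = 2" and e: "{v, w} \<in> G"
  shows "family_degree G {v, w} + 2 = card (nbrs G v) + card (nbrs G w)"
proof -
  have vw: "v \<noteq> w" using assms(2) e by force
  define s where "s u = {W \<in> G. u \<in> W}" for u
  have fin: "finite (s u)" for u using assms(1) by (simp add: s_def)
  have card_s: "card (s u) = card (nbrs G u)" for u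
    using bij_betw_same_card[OF bij_betw_nbrs[OF assms(2)]] by (metis s_def)
  have both: "W = {v, w}" if "W \<in> G" "v \<in> W" "w \<in> W" for W
  proof -
    have "card W = 2" using assms(2) that(1) by auto
    moreover have "{v, w} \<subseteq> W" using that by auto
    ultimately show ?thesis
      using vw card_subset_eq[of W "{v, w}"] card_ge_0_finite[of W] by auto
  qed
  have "{W \<in> G - {{v, w}}. W \<inter> {v, w} \<noteq> {}} = (s v - {{v, w}}) \<union> (s w - {{v, w}})"
    by (auto simp: s_def)
  moreover have "(s v - {{v, w}}) \<inter> (s w - {{v, w}}) = {}"
    using both by (auto simp: s_def)
  ultimately have "family_degree G {v, w} = card (s v - {{v, w}}) + card (s w - {{v, w}})"
    using fin by (simp add: family_degree_def card_Un_disjoint)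
  moreover have "{v, w} \<in> s v" "{v, w} \<in> s w" using e by (auto simp: s_def)
  moreover have "Suc (card (s u - {V})) = card (s u)" if "V \<in> s u" for u V
    using card_Suc_Diff1[OF fin that] .
  ultimately show ?thesis
    by (metis add_Suc add_Suc_right card_s add_2_eq_Suc')
qed

section \<open>Generators and projections\<close>

text \<open>A member that is not a generator is the union of its proper submembers, so one of these
  contains \<open>x\<close>; descend by induction.\<close>

lemma generator_subset:
  assumes "\<forall>A\<in>\<F>. finite A" and "V \<in> \<F>" and "x \<in> V"
  obtains W where "W \<in> union_generators \<F>" "x \<in> W" "W \<subseteq> V"
proof -
  have "finite V" using assms by auto
  then have "\<exists>W\<in>union_generators \<F>. x \<in> W \<and> W \<subseteq> V"
    using assms(2,3)
  proof (induction V rule: finite_psubset_induct)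
    case (psubset V)
    show ?case
    proof (cases "V \<in> union_generators \<F>")
      case False
      then have "V = \<Union>{W \<in> \<F>. W \<subset> V}"
        using psubset.prems by (auto simp: union_generators_def)
      then obtain W where "W \<in> \<F>" "W \<subset> V" "x \<in> W"
        using psubset.prems by blast
      then obtain W' where W': "W' \<in> union_generators \<F>" "x \<in> W'" "W' \<subseteq> W"
        using psubset.IH by meson
      have "W' \<subseteq> V" using W'(3) \<open>W \<subset> V\<close> by (meson psubset_imp_subset subset_trans)
      then show ?thesis using W' by meson
    qed (use psubset.prems in auto)
  qed
  then show ?thesis using that by blast
qed

lemma union_closed_UN:
  assumes "union_closed \<F>" and "{} \<in> \<F>" and "finite I" and "\<And>i. i \<in> I \<Longrightarrow> f i \<in> \<F>"
  shows "(\<Union>i\<in>I. f i) \<in> \<F>"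
  using assms(3,4) by induction (use assms(1,2) in \<open>auto simp: union_closed_def\<close>)

lemma family_proj_subset: "family_proj \<F> X \<subseteq> X"
  by (auto simp: family_proj_def)

lemma family_projI: "V \<in> \<F> \<Longrightarrow> V \<subseteq> X \<Longrightarrow> x \<in> V \<Longrightarrow> x \<in> family_proj \<F> X"
  by (auto simp: family_proj_def)

lemma family_proj_mono: "X \<subseteq> Y \<Longrightarrow> family_proj \<F> X \<subseteq> family_proj \<F> Y"
  by (auto simp: family_proj_def)

section \<open>Elements of \<open>E(X)\<close> when generators have size at most two\<close>

locale two_generated =
  fixes \<F> :: "'a set set" and U :: "'a set" and a b :: 'a
  assumes fin: "finite \<F>" and fin_mem: "\<forall>A\<in>\<F>. finite A"
    and uc: "union_closed \<F>" and empty_mem: "{} \<in> \<F>"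
    and gen_card: "\<forall>V\<in>union_generators \<F>. card V = 1 \<or> card V = 2"
    and U_eq: "U = {a, b}" and a_neq_b: "a \<noteq> b" and U_gen: "U \<in> union_generators \<F>"
begin

abbreviation "nb \<equiv> nbrs (union_generators2 \<F>)"

lemma edges: "finite (union_generators2 \<F>)" "\<forall>V\<in>union_generators2 \<F>. card V = 2"
  using fin by (auto simp: union_generators2_def union_generators_def)

lemma nb_mem: "w \<in> nb v \<Longrightarrow> {v, w} \<in> \<F>"
  by (auto simp: nbrs_def union_generators2_def union_generators_def)

lemma nb_irrefl: "w \<in> nb v \<Longrightarrow> w \<noteq> v"
  by (auto simp: nbrs_def union_generators2_def)

lemma U_mem: "U \<in> \<F>"
  using U_gen by (auto simp: union_generators_def)

text \<open>A generator through \<open>x\<close> inside \<open>X \<union> U\<close> either lies in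
  \<open>X\<close> or is an edge from \<open>x\<close> to \<open>a\<close> or \<open>b\<close>.
  Hence only neighbours of \<open>a\<close> and \<open>b\<close> can drop out of the projection when
  elements of \<open>U\<close> are removed.\<close>

lemma mem_proj_Un_U:
  assumes "x \<in> family_proj \<F> (X \<union> U) - U"
  shows "x \<in> family_proj \<F> X \<or> (x \<in> X \<and> (x \<in> nb a \<or> x \<in> nb b))"
proof -
  have xX: "x \<in> X" using assms family_proj_subset[of \<F> "X \<union> U"] by auto
  obtain V where "V \<in> \<F>" "V \<subseteq> X \<union> U" "x \<in> V"
    using assms by (auto simp: family_proj_def)
  then obtain W where W: "W \<in> union_generators \<F>" "x \<in> W" "W \<subseteq> X \<union> U"
    using generator_subset[OF fin_mem] by (metis subset_trans)
  show ?thesis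
  proof (cases "W \<subseteq> X")
    case True
    then show ?thesis using W family_projI[of W \<F> X x] by (auto simp: union_generators_def)
  next
    case False
    then obtain u where u: "u \<in> W" "u \<in> U" using W by auto
    have "u \<noteq> x" using u assms by auto
    then have "card W \<noteq> 1" using u W by (metis card_1_singletonE singletonD)
    then have W2: "card W = 2" using gen_card W(1) by auto
    then have "W = {u, x}"
      using u(1) W(2) \<open>u \<noteq> x\<close> by (metis card_2_iff doubleton_eq_iff insertE singletonD)
    then have "x \<in> nb u" using W(1) W2 by (auto simp: nbrs_def union_generators2_def)
    then show ?thesis using u xX U_eq by auto
  qed
qed

lemma E_set_U: "U \<in> E_set \<F> U X"
  using family_projI[OF U_mem, of "X \<union> U"] by (auto simp: E_set_def)

lemma E_set_empty:
  assumes "X \<inter> U = {}" and "X \<inter> (nb a \<union> nb b) \<subseteq> family_proj \<F> X"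
  shows "{} \<in> E_set \<F> U X"
proof -
  have "family_proj \<F> (X \<union> U) - U \<subseteq> family_proj \<F> X"
    using mem_proj_Un_U assms(2) by blast
  then show ?thesis
    using assms(1) family_proj_subset[of \<F> X] by (auto simp: E_set_def)
qed

text \<open>An edge from \<open>u\<close> into \<open>X\<close> puts \<open>u\<close> into the
  projection, and such edges cover all of \<open>X \<inter> nb u\<close>. The form of the first
  assumption lets \<open>a\<close> and \<open>b\<close> swap roles.\<close>

lemma E_set_singleton:
  assumes "{u, v} = {a, b}" and "X \<inter> U = {}" and "X \<inter> nb u \<noteq> {}"
    and "X \<inter> nb v \<subseteq> family_proj \<F> X \<union> nb u"
  shows "{u} \<in> E_set \<F> U X"
proof -
  have u: "x \<in> family_proj \<F> (X \<union> {u})" "u \<in> family_proj \<F> (X \<union> {u})"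
    if "x \<in> X" "x \<in> nb u" for x
    using family_projI[OF nb_mem[OF that(2)]] that(1) by auto
  have "family_proj \<F> (X \<union> {u}) \<inter> U = {u}"
    using u assms(1-3) family_proj_subset[of \<F> "X \<union> {u}"] U_eq by blast
  moreover have "family_proj \<F> (X \<union> U) - U \<subseteq> family_proj \<F> (X \<union> {u})"
  proof
    fix x assume "x \<in> family_proj \<F> (X \<union> U) - U"
    then have "x \<in> family_proj \<F> X \<or> (x \<in> X \<and> x \<in> nb u)"
      using mem_proj_Un_U[of x X] assms(1,4) by (auto simp: doubleton_eq_iff)
    then show "x \<in> family_proj \<F> (X \<union> {u})"
      using u family_proj_mono[of X "X \<union> {u}" \<F>] by auto
  qed
  ultimately show ?thesis
    using assms(1) U_eq by (auto simp: E_set_def)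
qed

lemma finite_E_set: "finite (E_set \<F> U X)"
  by (rule finite_subset[of _ "Pow U"]) (auto simp: E_set_def U_eq)

lemma two_le_card_E_set:
  assumes "Y \<in> E_set \<F> U X" and "Y \<noteq> U"
  shows "2 \<le> card (E_set \<F> U X)"
proof -
  have "card {Y, U} \<le> card (E_set \<F> U X)"
    using assms E_set_U finite_E_set by (intro card_mono) auto
  then show ?thesis using assms(2) by simp
qed

text \<open>This is not graph connectivity: it says that no vertex of \<open>S\<close> in
  \<open>X\<close> is isolated. Only neighbours outside \<open>U\<close> count, as these may be
  adjoined while keeping \<open>X\<close> disjoint from \<open>U\<close>.\<close>

definition connected_on :: "'a set \<Rightarrow> 'a set \<Rightarrow> bool" where
  "connected_on S X \<longleftrightarrow> (\<forall>y\<in>S \<inter> X. (nb y - U) \<inter> X \<noteq> {})"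

lemma connected_on_proj:
  assumes "connected_on S X" and "y \<in> S" and "y \<in> X"
  shows "y \<in> family_proj \<F> X"
proof -
  obtain z where "z \<in> nb y" "z \<in> X"
    using assms by (auto simp: connected_on_def)
  then show ?thesis using family_projI[OF nb_mem] assms(3) by blast
qed

lemma card_E_set_ge:
  assumes X: "X \<inter> U = {}" and meet: "X \<inter> (nb a \<union> nb b) \<noteq> {}"
  shows "1 + of_bool (connected_on (nb a - nb b - U) X) + of_bool (connected_on (nb b - nb a - U) X)
           \<le> card (E_set \<F> U X)" (is "1 + of_bool ?A + of_bool ?B \<le> _")
proof -
  \<comment> \<open>\<open>I\<close> holds the neighbours of \<open>a\<close> or \<open>b\<close> in
    \<open>X\<close> that need an edge to \<open>U\<close> to be covered. The first event forces
    \<open>I\<close> into \<open>nb b\<close>, the second into \<open>nb a\<close>. Then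
    \<open>{}\<close> works for empty \<open>I\<close>, and \<open>{u}\<close> for nonempty
    \<open>I\<close> inside \<open>nb u\<close>.\<close>
  define I where "I = X \<inter> (nb a \<union> nb b) - family_proj \<F> X"
  have IA: "I \<subseteq> nb b" if ?A
    using connected_on_proj[OF that] X by (auto simp: I_def)
  have IB: "I \<subseteq> nb a" if ?B
    using connected_on_proj[OF that] X by (auto simp: I_def)
  have E0: "{} \<in> E_set \<F> U X" if "I = {}"
    using that by (intro E_set_empty[OF X]) (auto simp: I_def)
  have Ea: "{a} \<in> E_set \<F> U X" if "I \<subseteq> nb a" "X \<inter> nb a \<noteq> {}"
    using that by (intro E_set_singleton[of a b, OF _ X]) (auto simp: I_def)
  have Eb: "{b} \<in> E_set \<F> U X" if "I \<subseteq> nb b" "X \<inter> nb b \<noteq> {}"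
    using that by (intro E_set_singleton[of b a, OF _ X]) (auto simp: I_def)
  have IX: "I \<subseteq> X" by (auto simp: I_def)
  have ne: "{} \<noteq> U" "{a} \<noteq> U" "{b} \<noteq> U" using U_eq a_neq_b by auto
  have two: "2 \<le> card (E_set \<F> U X)" if "?A \<or> ?B"
  proof (cases "I = {}")
    case True
    then show ?thesis using two_le_card_E_set[OF E0] ne by auto
  next
    case False
    then have "{a} \<in> E_set \<F> U X \<or> {b} \<in> E_set \<F> U X"
      using that IA IB Ea Eb IX by blast
    then show ?thesis using two_le_card_E_set ne by auto
  qed
  have three: "3 \<le> card (E_set \<F> U X)" if "?A" "?B"
  proof -
    have three': "3 \<le> card (E_set \<F> U X)"
      if "Y \<in> E_set \<F> U X" "Z \<in> E_set \<F> U X" "Y \<noteq> Z" "Y \<noteq> U" "Z \<noteq> U" for Y Z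
    proof -
      have "card {Y, Z, U} \<le> card (E_set \<F> U X)"
        using that E_set_U finite_E_set by (intro card_mono) auto
      then show ?thesis using that by simp
    qed
    have I: "I \<subseteq> nb a" "I \<subseteq> nb b" using IA IB that by auto
    show ?thesis
    proof (cases "I = {}")
      case True
      \<comment> \<open>Besides \<open>{}\<close> and \<open>U\<close> a third element is needed;
        \<open>meet\<close> provides an edge from \<open>a\<close> or \<open>b\<close> into
        \<open>X\<close>.\<close>
      have "{a} \<in> E_set \<F> U X \<or> {b} \<in> E_set \<F> U X"
        using meet Ea Eb I by blast
      then show ?thesis using three'[OF E0[OF True]] ne by auto
    next
      case False
      then have "{a} \<in> E_set \<F> U X" "{b} \<in> E_set \<F> U X"
        using I IX Ea Eb by blast+
      then show ?thesis using three' ne a_neq_b by auto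
    qed
  qed
  have "1 \<le> card (E_set \<F> U X)"
    using E_set_U finite_E_set by (metis One_nat_def Suc_leI card_gt_0_iff empty_iff)
  then show ?thesis using two three by (cases ?A; cases ?B) auto
qed

section \<open>The degree hypothesis and the averaging argument\<close>

text \<open>The edges \<open>{u, v}\<close> and \<open>{u, x}\<close> share the endpoint
  \<open>u\<close>, so comparing their degrees compares \<open>nb v\<close> with
  \<open>nb x\<close>. Each of these sets meets \<open>U\<close> in \<open>u\<close> alone, so
  removing \<open>U\<close> costs one element on either side.\<close>

lemma card_nb_ge:
  assumes deg: "\<forall>V\<in>union_generators2 \<F>. V \<inter> U \<noteq> {} \<longrightarrow>
           family_degree (union_generators2 \<F>) V \<ge> family_degree (union_generators2 \<F>) U"
    and uv: "{u, v} = {a, b}" and x: "x \<in> nb u - nb v - U"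
  shows "card (nb v - U) \<le> card (nb x - U)"
proof -
  have U: "U = {u, v}" and neq: "u \<noteq> v" using uv U_eq a_neq_b by (auto simp: doubleton_eq_iff)
  have eU: "{u, v} \<in> union_generators2 \<F>"
    using U_gen neq by (auto simp: union_generators2_def U)
  have ex: "{u, x} \<in> union_generators2 \<F>" using x by (auto simp: nbrs_def)
  have "family_degree (union_generators2 \<F>) {u, v} \<le> family_degree (union_generators2 \<F>) {u, x}"
    using deg[rule_format, OF ex] by (simp add: U)
  then have "card (nb v) \<le> card (nb x)"
    using family_degree_edge[OF edges eU] family_degree_edge[OF edges ex] by linarith
  moreover have "nb v - U = nb v - {u}" "u \<in> nb v"
    using nb_irrefl eU by (auto simp: U nbrs_def insert_commute)
  moreover have "nb x - U = nb x - {u}" "u \<in> nb x"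
    using x by (auto simp: U nbrs_sym)
  ultimately show ?thesis
    using finite_nbrs[OF edges] by (simp add: card_Diff_singleton)
qed

text \<open>\<open>\<Omega>\<close> abstracts the traces of an extension outside \<open>U\<close>.
  The sum is split according to whether \<open>X\<close> meets
  \<open>nb a \<union> nb b\<close>.\<close>

lemma sum_card_E_set_ge:
  assumes deg: "\<forall>V\<in>union_generators2 \<F>. V \<inter> U \<noteq> {} \<longrightarrow>
           family_degree (union_generators2 \<F>) V \<ge> family_degree (union_generators2 \<F>) U"
    and fin_\<Omega>: "finite \<Omega>" and disj: "\<And>X. X \<in> \<Omega> \<Longrightarrow> X \<inter> U = {}"
    and closed: "\<And>X V. X \<in> \<Omega> \<Longrightarrow> V \<in> \<F> \<Longrightarrow> X \<union> (V - U) \<in> \<Omega>"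
  shows "2 * real (card \<Omega>) \<le> (\<Sum>X\<in>\<Omega>. real (card (E_set \<F> U X)))"
proof -
  define \<Omega>\<^sub>1 where "\<Omega>\<^sub>1 = {X \<in> \<Omega>. X \<inter> (nb a \<union> nb b) \<noteq> {}}"
  have fin1: "finite \<Omega>\<^sub>1" "\<Omega>\<^sub>1 \<subseteq> \<Omega>" using fin_\<Omega> by (auto simp: \<Omega>\<^sub>1_def)
  define G where "G S = {X \<in> \<Omega>\<^sub>1. connected_on S X}" for S
  have G_ge: "real (card \<Omega>\<^sub>1) * (1 - 1 / 2 ^ card (nb v - U)) ^ card (nb u - U)
                \<le> real (card (G (nb u - nb v - U)))" if uv: "{u, v} = {a, b}" for u v
  proof -
    let ?S = "nb u - nb v - U"
    have "real (card \<Omega>\<^sub>1) * (1 - 1 / 2 ^ card (nb v - U)) ^ card ?S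
        \<le> real (card {X \<in> \<Omega>\<^sub>1. \<forall>y\<in>?S \<inter> X. (nb y - U) \<inter> X \<noteq> {}})"
    proof (rule card_nonisolated_ge)
      show "finite ?S" using finite_nbrs[OF edges] by auto
      show "finite \<Omega>\<^sub>1" by (fact fin1)
      show "z \<in> nb y - U" if "y \<in> ?S" "z \<in> ?S" "y \<in> nb z - U" for y z
        using that by (auto simp: nbrs_sym)
      show "finite (nb y - U) \<and> card (nb v - U) \<le> card (nb y - U)" if "y \<in> ?S" for y
        using card_nb_ge[OF deg uv that] finite_nbrs[OF edges] by auto
      show "X \<union> Z \<in> \<Omega>\<^sub>1" if "X \<in> \<Omega>\<^sub>1" "y \<in> ?S" "y \<in> X" "Z \<subseteq> nb y - U" for X y Z
      proof -
        have "finite Z" using that(4) finite_nbrs[OF edges] by (metis finite_Diff finite_subset)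
        \<comment> \<open>The star joining \<open>y\<close> to \<open>Z\<close> is a member, and as
          \<open>y\<close> is already in \<open>X\<close> its trace adds exactly
          \<open>Z\<close>.\<close>
        then have "(\<Union>z\<in>Z. {y, z}) \<in> \<F>"
          using that(4) nb_mem by (intro union_closed_UN[OF uc empty_mem]) auto
        then have "X \<union> ((\<Union>z\<in>Z. {y, z}) - U) \<in> \<Omega>"
          using closed that(1) fin1 by blast
        moreover have "X \<union> ((\<Union>z\<in>Z. {y, z}) - U) = X \<union> Z"
          using that by auto
        ultimately show ?thesis using that(1) by (auto simp: \<Omega>\<^sub>1_def)
      qed
    qed
    \<comment> \<open>The base is in \<open>[0, 1]\<close>, so the exponent may grow to
      \<open>card (nb u - U)\<close>, which gives the shape of
      \<open>one_le_sum_powers\<close>.\<close>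
    moreover have "(1 - 1 / 2 ^ card (nb v - U) :: real) ^ card (nb u - U)
        \<le> (1 - 1 / 2 ^ card (nb v - U)) ^ card ?S"
      using finite_nbrs[OF edges] by (intro power_decreasing card_mono) auto
    ultimately show ?thesis
      unfolding G_def connected_on_def
      by (meson mult_left_mono of_nat_0_le_iff order_trans)
  qed
  define GA GB where "GA = G (nb a - nb b - U)" and "GB = G (nb b - nb a - U)"
  have "real (card \<Omega>\<^sub>1) * 1 \<le> real (card \<Omega>\<^sub>1)
      * ((1 - 1 / 2 ^ card (nb b - U)) ^ card (nb a - U)
         + (1 - 1 / 2 ^ card (nb a - U)) ^ card (nb b - U))"
    by (intro mult_left_mono one_le_sum_powers) auto
  also have "\<dots> \<le> real (card GA) + real (card GB)"
    using G_ge[of a b] G_ge[of b a] by (auto simp: GA_def GB_def insert_commute distrib_left)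
  finally have sum_G: "real (card \<Omega>\<^sub>1) \<le> real (card GA) + real (card GB)" by simp
  have cardG: "real (card (G S)) = (\<Sum>X\<in>\<Omega>\<^sub>1. of_bool (connected_on S X))" for S
    using fin1(1) by (simp add: G_def of_bool_def sum.If_cases Int_def)
  have "2 * real (card \<Omega>\<^sub>1) \<le> real (card \<Omega>\<^sub>1) + real (card GA) + real (card GB)"
    using sum_G by simp
  also have "\<dots> = (\<Sum>X\<in>\<Omega>\<^sub>1. 1 + of_bool (connected_on (nb a - nb b - U) X)
                        + of_bool (connected_on (nb b - nb a - U) X))"
    by (simp add: sum.distrib cardG GA_def GB_def)
  also have "\<dots> \<le> (\<Sum>X\<in>\<Omega>\<^sub>1. real (card (E_set \<F> U X)))"
  proof (rule sum_mono)
    fix X assume "X \<in> \<Omega>\<^sub>1"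
    then have "1 + of_bool (connected_on (nb a - nb b - U) X)
        + of_bool (connected_on (nb b - nb a - U) X) \<le> card (E_set \<F> U X)"
      using disj by (intro card_E_set_ge) (auto simp: \<Omega>\<^sub>1_def)
    then show "1 + of_bool (connected_on (nb a - nb b - U) X)
        + of_bool (connected_on (nb b - nb a - U) X) \<le> real (card (E_set \<F> U X))"
      by (simp add: of_bool_def split: if_splits)
  qed
  finally have part1: "2 * real (card \<Omega>\<^sub>1) \<le> (\<Sum>X\<in>\<Omega>\<^sub>1. real (card (E_set \<F> U X)))" .
  have "(\<Sum>X\<in>\<Omega> - \<Omega>\<^sub>1. 2) \<le> (\<Sum>X\<in>\<Omega> - \<Omega>\<^sub>1. real (card (E_set \<F> U X)))"
  proof (rule sum_mono)
    fix X assume "X \<in> \<Omega> - \<Omega>\<^sub>1"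
    then have "{} \<in> E_set \<F> U X"
      using disj by (intro E_set_empty) (auto simp: \<Omega>\<^sub>1_def)
    then have "2 \<le> card (E_set \<F> U X)"
      by (rule two_le_card_E_set) (simp add: U_eq)
    then show "2 \<le> real (card (E_set \<F> U X))" by simp
  qed
  then have part2: "2 * real (card (\<Omega> - \<Omega>\<^sub>1)) \<le> (\<Sum>X\<in>\<Omega> - \<Omega>\<^sub>1. real (card (E_set \<F> U X)))"
    by simp
  have "real (card \<Omega>) = real (card \<Omega>\<^sub>1) + real (card (\<Omega> - \<Omega>\<^sub>1))"
    using fin1 fin_\<Omega> card_Diff_subset[of \<Omega>\<^sub>1 \<Omega>] card_mono[of \<Omega> \<Omega>\<^sub>1] by simp
  moreover have "(\<Sum>X\<in>\<Omega>. real (card (E_set \<F> U X)))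
      = (\<Sum>X\<in>\<Omega> - \<Omega>\<^sub>1. real (card (E_set \<F> U X))) + (\<Sum>X\<in>\<Omega>\<^sub>1. real (card (E_set \<F> U X)))"
    using sum.subset_diff[OF fin1(2) fin_\<Omega>] .
  ultimately show ?thesis using part1 part2 by linarith
qed

end

section \<open>Application to extensions\<close>

theorem theorem3p29:
  fixes \<F> :: "'a set set" and U :: "'a set" and a b :: 'a
  assumes "finite \<F>" and "\<forall>A\<in>\<F>. finite A"
    and "union_closed \<F>" and "{} \<in> \<F>"
    and "\<forall>V\<in>union_generators \<F>. card V = 1 \<or> card V = 2"
    and "U = {a, b}" and "a \<noteq> b" and "U \<in> union_generators \<F>"
    and "\<F> = nbhd3 \<F> U"
    and "\<forall>V\<in>union_generators2 \<F>. V \<inter> U \<noteq> {} \<longrightarrow>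
           family_degree (union_generators2 \<F>) V \<ge> family_degree (union_generators2 \<F>) U"
  shows "\<forall>\<F>'. is_extension \<F> U \<F>' \<longrightarrow> mu \<F> \<F>' U \<ge> 2"
proof (intro allI impI)
  fix \<F>' assume "is_extension \<F> U \<F>'"
  then obtain \<H> where H: "finite \<H>" "\<H> \<noteq> {}" and F': "\<F>' = family_join \<F> \<H>"
    by (auto simp: is_extension_def)
  interpret two_generated \<F> U a b
    by unfold_locales (fact assms)+
  define \<Omega> where "\<Omega> = family_minus \<F>' U"
  have \<Omega>_eq: "\<Omega> = (\<lambda>(A, B). (A \<union> B) - U) ` (\<F> \<times> \<H>)"
    by (auto simp: \<Omega>_def family_minus_def F' family_join_def)
  have fin_\<Omega>: "finite \<Omega>" and "\<Omega> \<noteq> {}"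
    using H fin empty_mem by (auto simp: \<Omega>_eq)
  then have pos: "0 < real (card \<Omega>)" by (simp add: card_gt_0_iff)
  have closed: "X \<union> (V - U) \<in> \<Omega>" if X: "X \<in> \<Omega>" and V: "V \<in> \<F>" for X V
  proof -
    obtain A B where AB: "A \<in> \<F>" "B \<in> \<H>" "X = (A \<union> B) - U"
      using X by (auto simp: \<Omega>_eq)
    \<comment> \<open>Union-closedness lets the component from \<open>\<F>\<close> absorb
      \<open>V\<close>.\<close>
    have "(A \<union> V, B) \<in> \<F> \<times> \<H>"
      using AB V uc by (auto simp: union_closed_def)
    moreover have "X \<union> (V - U) = (\<lambda>(A, B). (A \<union> B) - U) (A \<union> V, B)"
      using AB by auto
    ultimately show ?thesis unfolding \<Omega>_eq by (rule rev_image_eqI)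
  qed
  have "2 * real (card \<Omega>) \<le> (\<Sum>X\<in>\<Omega>. real (card (E_set \<F> U X)))"
    by (rule sum_card_E_set_ge[OF assms(10) fin_\<Omega> _ closed]) (auto simp: \<Omega>_eq)
  then show "mu \<F> \<F>' U \<ge> 2"
    using pos by (simp add: mu_def flip: \<Omega>_def) (simp add: field_simps)
qed

end
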